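(* Let $\rho\colon G_{\widehat I}\to\mathbb{U}_n$ be a globalization for the $I$-indexed Kummer linking structure $\mathcal{G}_{\widehat I,I}$ of $F$ unramified outside $\widehat I$, let $E_\rho$ be the associated Galois extension of $F$, and let $j\in J_{\mathrm{val}}\setminus\widehat I$ be such that $\rho(\mathrm{res}_j(Z_j))\subseteq\mathbb{V}_n$. Then $[\widehat I,I,j]=0$ if and only if the valuation $v_j$ is completely decomposed in $E_\rho$.
   Context: Field-theoretic setup. Let $p$ be a prime, $q>1$ a $p$-power, and $F$ a field containing a root of unity of (exact) order $q$; fix an isomorphism $\mu_q\cong\mathbb{Z}/q$. $F(p)$ is the maximal pro-$p$ Galois extension of $F$ and $G=\mathrm{Gal}(F(p)/F)$. Let $v_j$, $j\in J_{\mathrm{val}}$, be non-equivalent non-trivial (Krull) valuations on $F$; for each fix an extension $u_j$ to $F(p)$, and let $Z_j=\{\sigma\in G:u_j\circ\sigma=u_j\}$ and $T_j=\{\sigma\in G:\forall a\in O_{u_j}\ u_j(\sigma(a)-a)>0\}$ be its decomposition and inertia groups over $F$. If $p=2$, let $P_j$, $j\in J_{\mathrm{ord}}$, be distinct orderings on $F$ (additively closed subgroups of $F^\times$ of index $2$); for each choose a relative real closure $F_{P_j}$ of $F$ in $F(2)$ at $P_j$ (a maximal extension of $F$ in $F(2)$ having an ordering that extends $P_j$), and set $Z_j=T_j=\mathrm{Gal}(F(2)/F_{P_j})\cong\mathbb{Z}/2$. If $p\ne2$, $J_{\mathrm{ord}}=\emptyset$. Let $J$ be the disjoint union of $J_{\mathrm{val}}$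 and $J_{\mathrm{ord}}$. Let $I=\{i_1,\ldots,i_n\}\subseteq J$ consist of $n\ge1$ distinct elements, $I_{\mathrm{val}}=I\cap J_{\mathrm{val}}$, $I_{\mathrm{ord}}=I\cap J_{\mathrm{ord}}$, such that for $i\in I_{\mathrm{val}}$ the valuation $v_i$ is discrete (value group $\mathbb{Z}$) with residue characteristic $\ne p$, and such that $v_i$ ($i\in I_{\mathrm{val}}$), $P_i$ ($i\in I_{\mathrm{ord}}$) are independent (induce distinct topologies on $F$). Then $Z_i=T_i\rtimes\bar Z_i$ with $\bar Z_i=Z_i/T_i$ for $i\in I$. Choose $t_i\in F^\times$ ($i\in I$) such that $t_i$ is a uniformizer for $v_i$ if $i\in I_{\mathrm{val}}$; $t_i\in-P_i$ if $i\in I_{\mathrm{ord}}$; $t_i$ is a $v_{i'}$-unit for all $i\ne i'\in I_{\mathrm{val}}$; and $t_i\in P_{i'}$ for all $i\neq i'\in I_{\mathrm{ord}}$ (such elements exist). Let $\bar\pi_i=\kappa_{t_i}\colon T_i\to\mu_q\cong\mathbb{Z}/q$ be the Kummer map $\sigma\mapsto\sigma(\sqrt[q]{t_i})/\sqrt[q]{t_i}$; it is surjective and independent of the choice of $t_i$. Let $\mathbb{U}_n$ be the group of unipotent upper-triangular $(n+1)\times(n+1)$ matrices over $\mathbb{Z}/q$, let $\mathbb{V}_n=\{\mathrm{Id}+rE_{1,n+1}:r\in\mathbb{Z}/q\}$, and define $\pi_i\colon T_i\to\mathbb{U}_n$, $\pi_i(\tau)=\mathrm{Id}+\bar\pi_i(\tau)E_{l,l+1}$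 for $i=i_l$. Let $I\subseteq\widehat I\subseteq J$, let $N_{\widehat I}$ be the closed normal subgroup of $G$ generated by $T_j$, $j\in J\setminus\widehat I$, and $G_{\widehat I}=G/N_{\widehat I}$, with natural maps $\mathrm{res}_j\colon Z_j\to G_{\widehat I}$. Assume that the images of $T_i$, $i\in I$, generate $G_{\widehat I}$ as a pro-$p$ group. The $I$-indexed Kummer linking structure of $F$ unramified outside $\widehat I$ is $\mathcal{G}_{\widehat I,I}=(G_{\widehat I},\mathbb{U}_n,Z_i,T_i,\mathrm{res}_i,\pi_i)_{i\in I}$; a globalization for it is a pro-$p$ homomorphism $\rho\colon G_{\widehat I}\to\mathbb{U}_n$ with $\rho\circ\mathrm{res}_i=\pi_i$ on $T_i$ for all $i\in I$. $E_\rho$ is the fixed field in $F(p)$ of the kernel of $G\to G_{\widehat I}\xrightarrow{\rho}\mathbb{U}_n$; it is a Galois extension of $F$. For $j\in J\setminus\widehat I$ with $\rho(\mathrm{res}_j(Z_j))\subseteq\mathbb{V}_n$, the linking invariant is the homomorphism $[\widehat I,I,j]=\mathrm{pr}_{1,n+1}\circ\rho\circ\mathrm{res}_j\colon Z_j\to\mathbb{Z}/q$, where $\mathrm{pr}_{1,n+1}$ is the projection to the $(1,n+1)$-entry. A valuation $v_j$ is completely decomposed in $E_\rho$ if its decomposition group in $\mathrm{Gal}(E_\rho/F)$ (the image of $Z_j$) is trivial. *)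

theory Defs
  imports
    "HOL-Analysis.Abstract_Topology"
    "HOL-Algebra.Algebraic_Closure_Type"
    "HOL-Algebra.Embedded_Algebras"
    "HOL-Algebra.Bij"
    "HOL-Algebra.Coset"
    "HOL-Algebra.Generated_Groups"
    "Berlekamp_Zassenhaus.Finite_Field"
    "Jordan_Normal_Form.Matrix"
begin

text \<open>
  The ground field \<open>F\<close> is the whole type \<open>'a\<close>. All algebraic extensions of \<open>F\<close> are subsets of
  \<open>'a alg_closure\<close>, where \<open>F\<close> is embedded by \<^const>\<open>to_ac\<close>.
  The ring \<open>\<int>/q\<close> is the type \<open>'q mod_ring\<close> with \<open>q = CARD('q)\<close>.
\<close>

abbreviation base_field :: "'a::field alg_closure set" where
  "base_field \<equiv> range to_ac"

abbreviation ring_on :: "'b::field set \<Rightarrow> 'b ring" where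
  "ring_on K \<equiv> ring_of_type_algebra\<lparr>carrier := K\<rparr>"

definition intermediate_field :: "'a::field alg_closure set \<Rightarrow> 'a alg_closure set \<Rightarrow> bool" where
  "intermediate_field K L \<longleftrightarrow> subfield L ring_of_type_algebra \<and> base_field \<subseteq> L \<and> L \<subseteq> K"


subsection \<open>Galois groups and the maximal pro-p extension\<close>

definition Gal :: "'b::field set \<Rightarrow> 'b set \<Rightarrow> ('b \<Rightarrow> 'b) monoid" where
  "Gal K L = (BijGroup K)\<lparr>carrier :=
     {\<sigma> \<in> Bij K. \<sigma> \<in> Ring.ring_hom (ring_on K) (ring_on K) \<and> (\<forall>x\<in>L. \<sigma> x = x)}\<rparr>"

definition fixed_field :: "'b set \<Rightarrow> ('b \<Rightarrow> 'b) set \<Rightarrow> 'b set" where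
  "fixed_field K H = {x \<in> K. \<forall>\<sigma>\<in>H. \<sigma> x = x}"

text \<open>Every subextension of the algebraic closure is algebraic, so only the condition on the
  fixed field has to be required.\<close>

definition galois_extension :: "'a::field alg_closure set \<Rightarrow> bool" where
  "galois_extension K \<longleftrightarrow> intermediate_field UNIV K \<and>
     fixed_field K (carrier (Gal K base_field)) = base_field"

definition krull_topology :: "'a::field alg_closure set \<Rightarrow> ('a alg_closure \<Rightarrow> 'a alg_closure) topology" where
  "krull_topology K = topology_generated_by
     {\<tau> <#\<^bsub>Gal K base_field\<^esub> carrier (Gal K L) | \<tau> L.
        \<tau> \<in> carrier (Gal K base_field) \<and> intermediate_field K L \<and>
        ring.finite_dimension ring_of_type_algebra base_field L}"

definition pro_p_galois_extension :: "nat \<Rightarrow> 'a::field alg_closure set \<Rightarrow> bool" where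
  "pro_p_galois_extension p K \<longleftrightarrow> galois_extension K \<and>
     (\<forall>H. H \<lhd> Gal K base_field \<and> openin (krull_topology K) H
        \<longrightarrow> (\<exists>k. card (rcosets\<^bsub>Gal K base_field\<^esub> H) = p ^ k))"

definition maximal_pro_p_extension :: "nat \<Rightarrow> 'a::field alg_closure set \<Rightarrow> bool" where
  "maximal_pro_p_extension p K \<longleftrightarrow> pro_p_galois_extension p K \<and>
     (\<forall>L. pro_p_galois_extension p L \<longrightarrow> L \<subseteq> K)"

definition quotient_group_topology :: "('g, 'm) monoid_scheme \<Rightarrow> 'g topology \<Rightarrow> 'g set \<Rightarrow> 'g set topology" where
  "quotient_group_topology G Tp N =
     topology_generated_by {U. U \<subseteq> carrier (G Mod N) \<and> openin Tp (\<Union>U)}"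

definition closed_normal_closure :: "('g, 'm) monoid_scheme \<Rightarrow> 'g topology \<Rightarrow> 'g set \<Rightarrow> 'g set" where
  "closed_normal_closure G Tp S = \<Inter>{H. H \<lhd> G \<and> closedin Tp H \<and> S \<subseteq> H}"


subsection \<open>Krull valuations\<close>

text \<open>
  Valuations are written additively and are only meaningful on nonzero elements; the value
  \<open>\<infinity>\<close> at \<open>0\<close> is expressed by separate cases. The value group of a valuation is the image of the
  nonzero elements, an arbitrary subgroup of the ordered abelian group \<open>'v\<close>. Any
  family of ordered abelian groups embeds into a single one (their lexicographic direct sum),
  so a common type \<open>'v\<close> for a family of valuations is no restriction.
\<close>

definition valuation_on :: "'b::field set \<Rightarrow> ('b \<Rightarrow> 'v::linordered_ab_group_add) \<Rightarrow> bool" where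
  "valuation_on K v \<longleftrightarrow> (\<forall>x\<in>K - {0}. \<forall>y\<in>K - {0}.
     v (x * y) = v x + v y \<and> (x + y \<noteq> 0 \<longrightarrow> min (v x) (v y) \<le> v (x + y)))"

definition value_group :: "'b::field set \<Rightarrow> ('b \<Rightarrow> 'v::linordered_ab_group_add) \<Rightarrow> 'v set" where
  "value_group K v = v ` (K - {0})"

definition valuation_ring :: "'b::field set \<Rightarrow> ('b \<Rightarrow> 'v::linordered_ab_group_add) \<Rightarrow> 'b set" where
  "valuation_ring K v = {x \<in> K. x = 0 \<or> 0 \<le> v x}"

definition valuation_ideal :: "'b::field set \<Rightarrow> ('b \<Rightarrow> 'v::linordered_ab_group_add) \<Rightarrow> 'b set" where
  "valuation_ideal K v = {x \<in> K. x = 0 \<or> 0 < v x}"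

definition equivalent_valuations ::
  "('b::field \<Rightarrow> 'v::linordered_ab_group_add) \<Rightarrow> ('b \<Rightarrow> 'v) \<Rightarrow> bool" where
  "equivalent_valuations v w \<longleftrightarrow> valuation_ring UNIV v = valuation_ring UNIV w"

definition discrete_valuation :: "('b::field \<Rightarrow> 'v::linordered_ab_group_add) \<Rightarrow> bool" where
  "discrete_valuation v \<longleftrightarrow> (\<exists>f :: int \<Rightarrow> 'v. strict_mono f \<and> (\<forall>a b. f (a + b) = f a + f b) \<and>
     range f = value_group UNIV v)"

text \<open>As for \<^const>\<open>semiring_char\<close>, the characteristic of the residue field is the nonnegative
  generator of the kernel of the map from the integers.\<close>

definition residue_characteristic :: "('b::field \<Rightarrow> 'v::linordered_ab_group_add) \<Rightarrow> nat" where
  "residue_characteristic v = Gcd {n. of_nat n \<in> valuation_ideal UNIV v}"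

definition uniformizer :: "('b::field \<Rightarrow> 'v::linordered_ab_group_add) \<Rightarrow> 'b \<Rightarrow> bool" where
  "uniformizer v t \<longleftrightarrow> t \<noteq> 0 \<and> 0 < v t \<and> (\<forall>g\<in>value_group UNIV v. 0 < g \<longrightarrow> v t \<le> g)"

definition valuation_topology :: "('b::field \<Rightarrow> 'v::linordered_ab_group_add) \<Rightarrow> 'b topology" where
  "valuation_topology v = topology_generated_by
     {{y. y = x \<or> g < v (y - x)} | x g. g \<in> value_group UNIV v}"

definition decomposition_group ::
  "'a::field alg_closure set \<Rightarrow> ('a alg_closure \<Rightarrow> 'v::linordered_ab_group_add) \<Rightarrow>
     ('a alg_closure \<Rightarrow> 'a alg_closure) set" where
  "decomposition_group K u = {\<sigma> \<in> carrier (Gal K base_field). \<forall>x\<in>K - {0}. u (\<sigma> x) = u x}"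

definition inertia_group ::
  "'a::field alg_closure set \<Rightarrow> ('a alg_closure \<Rightarrow> 'v::linordered_ab_group_add) \<Rightarrow>
     ('a alg_closure \<Rightarrow> 'a alg_closure) set" where
  "inertia_group K u = {\<sigma> \<in> carrier (Gal K base_field).
     \<forall>a\<in>valuation_ring K u. \<sigma> a - a \<in> valuation_ideal K u}"

text \<open>For \<open>E \<subseteq> K\<close> Galois over \<open>F\<close>, the decomposition group in \<open>Gal(E/F)\<close> is the image of the
  one in \<open>Gal(K/F)\<close>.\<close>

definition completely_decomposed ::
  "'a::field alg_closure set \<Rightarrow> ('a alg_closure \<Rightarrow> 'v::linordered_ab_group_add) \<Rightarrow>
     'a alg_closure set \<Rightarrow> bool" where
  "completely_decomposed K u E \<longleftrightarrow>
     (\<lambda>\<sigma>. restrict \<sigma> E) ` decomposition_group K u = {\<one>\<^bsub>Gal E base_field\<^esub>}"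


subsection \<open>Orderings\<close>

definition field_ordering_on :: "'b::field set \<Rightarrow> 'b set \<Rightarrow> bool" where
  "field_ordering_on K P \<longleftrightarrow>
     subgroup P (Multiplicative_Group.mult_of (ring_on K)) \<and>
     card (rcosets\<^bsub>Multiplicative_Group.mult_of (ring_on K)\<^esub> P) = 2 \<and>
     (\<forall>x\<in>P. \<forall>y\<in>P. x + y \<in> P)"

definition ordering_topology :: "'b::field set \<Rightarrow> 'b topology" where
  "ordering_topology P = topology_generated_by {{y. y - a \<in> P \<and> b - y \<in> P} | a b. True}"

definition ordering_extends_to ::
  "'a::field alg_closure set \<Rightarrow> 'a set \<Rightarrow> 'a alg_closure set \<Rightarrow> bool" where
  "ordering_extends_to K P L \<longleftrightarrow> intermediate_field K L \<and>
     (\<exists>Q. field_ordering_on L Q \<and> Q \<inter> base_field = to_ac ` P)"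

definition relative_real_closure ::
  "'a::field alg_closure set \<Rightarrow> 'a set \<Rightarrow> 'a alg_closure set \<Rightarrow> bool" where
  "relative_real_closure K P R \<longleftrightarrow> ordering_extends_to K P R \<and>
     (\<forall>L. ordering_extends_to K P L \<and> R \<subseteq> L \<longrightarrow> L = R)"


subsection \<open>Kummer maps\<close>

definition roots_of_unity_group :: "nat \<Rightarrow> 'a::field monoid" where
  "roots_of_unity_group q =
     (Multiplicative_Group.mult_of ring_of_type_algebra)\<lparr>carrier := {x. x ^ q = 1}\<rparr>"

definition kummer_map ::
  "'a::field alg_closure set \<Rightarrow> ('a \<Rightarrow> 'q::nontriv mod_ring) \<Rightarrow> 'a \<Rightarrow>
     ('a alg_closure \<Rightarrow> 'a alg_closure) \<Rightarrow> 'q mod_ring" where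
  "kummer_map K \<iota> t \<sigma> =
     (let s = (SOME s. s \<in> K \<and> s ^ CARD('q) = to_ac t) in \<iota> (of_ac (\<sigma> s / s)))"


subsection \<open>Unipotent matrices\<close>

definition unipotent_group :: "nat \<Rightarrow> 'r::comm_ring_1 mat monoid" where
  "unipotent_group n =
     \<lparr>carrier = {A \<in> carrier_mat (n + 1) (n + 1). upper_triangular A \<and> (\<forall>i\<le>n. A $$ (i, i) = 1)},
      monoid.mult = (*), one = 1\<^sub>m (n + 1)\<rparr>"

text \<open>\<open>Id + r E\<^sub>k\<^sub>l\<close>, with rows and columns numbered from \<open>1\<close> as usual, whereas \<^typ>\<open>'r mat\<close>
  numbers them from \<open>0\<close>.\<close>

definition elementary_unipotent :: "nat \<Rightarrow> nat \<Rightarrow> nat \<Rightarrow> 'r::comm_ring_1 \<Rightarrow> 'r mat" where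
  "elementary_unipotent n k l r = 1\<^sub>m (n + 1) +
     mat (n + 1) (n + 1) (\<lambda>(a, b). if a + 1 = k \<and> b + 1 = l then r else 0)"

definition corner_subgroup :: "nat \<Rightarrow> 'r::comm_ring_1 mat set" where
  "corner_subgroup n = range (elementary_unipotent n 1 (n + 1))"


subsection \<open>Linking structures\<close>

record ('g, 'z, 'u, 'i) linking_structure =
  global_group :: "'g monoid"
  global_topology :: "'g topology"
  target_group :: "'u monoid"
  index_set :: "'i set"
  decomposition_at :: "'i \<Rightarrow> 'z set"
  inertia_at :: "'i \<Rightarrow> 'z set"
  res_at :: "'i \<Rightarrow> 'z \<Rightarrow> 'g"
  local_map :: "'i \<Rightarrow> 'z \<Rightarrow> 'u"

text \<open>The target group is finite and carries the discrete topology.\<close>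

definition globalization :: "('g, 'z, 'u, 'i) linking_structure \<Rightarrow> ('g \<Rightarrow> 'u) \<Rightarrow> bool" where
  "globalization S \<rho> \<longleftrightarrow>
     \<rho> \<in> hom (global_group S) (target_group S) \<and>
     continuous_map (global_topology S) (discrete_topology (carrier (target_group S))) \<rho> \<and>
     (\<forall>i\<in>index_set S. \<forall>\<tau>\<in>inertia_at S i. \<rho> (res_at S i \<tau>) = local_map S i \<tau>)"

definition linking_invariant ::
  "nat \<Rightarrow> ('g \<Rightarrow> 'r mat) \<Rightarrow> ('z \<Rightarrow> 'g) \<Rightarrow> 'z set \<Rightarrow> 'z \<Rightarrow> 'r" where
  "linking_invariant n \<rho> res Z = (\<lambda>\<sigma>\<in>Z. \<rho> (res \<sigma>) $$ (0, n))"

end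

theory Submission
  imports Defs "Jordan_Normal_Form.Determinant"
begin

text \<open>
  Let \<open>H\<close> be the kernel of the representation of the Galois group defined by \<open>\<rho>\<close>, so that \<open>E\<close> is the
  fixed field of \<open>H\<close>. The linking invariant is the corner entry of \<open>\<rho>\<close> on the decomposition group \<open>Z\<close> of
  \<open>v\<^sub>j\<close>, and an element of the corner subgroup is trivial exactly when its corner entry vanishes.
  Hence the invariant is zero if and only if \<open>Z \<subseteq> H\<close>. Complete decomposition, on the other hand, says
  that \<open>Z\<close> acts trivially on \<open>E\<close>. That \<open>Z \<subseteq> H\<close> implies this is clear; the converse is the statement of
  infinite Galois theory that \<open>H\<close>, being an open subgroup, contains every automorphism that fixes
  its fixed field (\<open>open_subgroup_contains_stabiliser_of_fixed_field\<close>).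

  The proof of this statement uses invariants instead of finite Galois theory. By openness, it suffices
  to show that an automorphism \<open>\<sigma>\<close> fixing the \<open>H\<close>-invariants of \<open>K\<close> agrees with some element of \<open>H\<close> on a given
  finite set \<open>{s\<^sub>0, \<dots>, s\<^sub>m}\<close> (\<open>krull_neighbourhood_of_one\<close>). The element \<open>f = \<Sum>\<^sub>i s\<^sub>i X\<^sup>i\<close> of \<open>K[X]\<close> has a finite
  \<open>H\<close>-orbit, since the \<open>s\<^sub>i\<close> are algebraic. The polynomial \<open>\<Prod>\<^sub>g (Y - g)\<close>, with \<open>g\<close> ranging over this
  orbit, has \<open>H\<close>-invariant coefficients in \<open>K[X]\<close>, so \<open>\<sigma>\<close> maps its root \<open>f\<close> to one of its roots, and
  these are the conjugates of \<open>f\<close> under \<open>H\<close> (\<open>fixing_invariants_preserves_orbits\<close>).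

  That \<open>H\<close> is indeed an open subgroup follows from the continuity of \<open>\<rho>\<close>
  (\<open>unipotent_kernel_open_subgroup\<close>).
\<close>

section \<open>Ring endomorphisms defined on a subring\<close>

text \<open>Elements of \<^term>\<open>Gal K L\<close> are only meaningful on \<open>K\<close>, so homomorphy is relativised to a subring. The
  ambient structure is a ring and not a field because \<open>K[X]\<close> is to be an instance as well.\<close>

locale subring_endomorphism =
  fixes K :: "'b::comm_ring_1 set" and f :: "'b \<Rightarrow> 'b"
  assumes one_mem: "1 \<in> K"
    and add_mem: "x \<in> K \<Longrightarrow> y \<in> K \<Longrightarrow> x + y \<in> K"
    and mult_mem: "x \<in> K \<Longrightarrow> y \<in> K \<Longrightarrow> x * y \<in> K"
    and uminus_mem: "x \<in> K \<Longrightarrow> - x \<in> K"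
    and map_mem: "x \<in> K \<Longrightarrow> f x \<in> K"
    and map_one: "f 1 = 1"
    and map_add: "x \<in> K \<Longrightarrow> y \<in> K \<Longrightarrow> f (x + y) = f x + f y"
    and map_mult: "x \<in> K \<Longrightarrow> y \<in> K \<Longrightarrow> f (x * y) = f x * f y"
begin

lemma zero_mem: "0 \<in> K"
  using add_mem[OF one_mem uminus_mem[OF one_mem]] by simp

lemma map_zero: "f 0 = 0"
  using map_add[OF zero_mem zero_mem] by simp

lemma map_uminus: "x \<in> K \<Longrightarrow> f (- x) = - f x"
  using map_add[of x "- x"] uminus_mem map_zero by (simp add: eq_neg_iff_add_eq_0 add.commute)

lemma sum_mem: "(\<And>a. a \<in> A \<Longrightarrow> r a \<in> K) \<Longrightarrow> sum r A \<in> K"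
  by (induction A rule: infinite_finite_induct) (auto simp: zero_mem add_mem)

lemma map_sum: "(\<And>a. a \<in> A \<Longrightarrow> r a \<in> K) \<Longrightarrow> f (sum r A) = (\<Sum>a\<in>A. f (r a))"
  by (induction A rule: infinite_finite_induct) (auto simp: map_zero map_add sum_mem)

lemma prod_mem: "(\<And>a. a \<in> A \<Longrightarrow> r a \<in> K) \<Longrightarrow> prod r A \<in> K"
  by (induction A rule: infinite_finite_induct) (auto simp: one_mem mult_mem)

lemma map_prod: "(\<And>a. a \<in> A \<Longrightarrow> r a \<in> K) \<Longrightarrow> f (prod r A) = (\<Prod>a\<in>A. f (r a))"
  by (induction A rule: infinite_finite_induct) (auto simp: map_one map_mult prod_mem)

lemma poly_mem: "(\<And>k. coeff p k \<in> K) \<Longrightarrow> x \<in> K \<Longrightarrow> poly p x \<in> K"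
proof (induction p)
  case (pCons a p)
  have "a \<in> K" and "\<And>k. coeff p k \<in> K"
    using pCons.prems(1)[of 0] pCons.prems(1)[of "Suc _"] by simp_all
  then show ?case
    using pCons by (simp add: add_mem mult_mem)
qed (simp add: zero_mem)

lemma map_poly_eval:
  assumes "\<And>k. coeff p k \<in> K" "x \<in> K"
  shows "f (poly p x) = poly (map_poly f p) (f x)"
  using assms
proof (induction p)
  case 0
  show ?case by (simp add: map_zero)
next
  case (pCons a p)
  have "a \<in> K" and p: "\<And>k. coeff p k \<in> K"
    using pCons.prems(1)[of 0] pCons.prems(1)[of "Suc _"] by simp_all
  then show ?case
    using pCons.IH pCons.prems(2) pCons.hyps
    by (simp add: map_poly_pCons map_zero map_add map_mult mult_mem poly_mem)
qed

text \<open>This makes every fact about \<open>f\<close> available for \<^term>\<open>map_poly f\<close>; in particular, \<^term>\<open>map_poly f\<close>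
  commutes with products of linear factors.\<close>

lemma subring_endomorphism_map_poly:
  "subring_endomorphism {p. \<forall>k. coeff p k \<in> K} (map_poly f)"
proof
  show "map_poly f 1 = 1"
    by (simp add: map_poly_1 map_one)
next
  fix p r :: "'b poly"
  assume "p \<in> {p. \<forall>k. coeff p k \<in> K}" "r \<in> {p. \<forall>k. coeff p k \<in> K}"
  then show "map_poly f (p * r) = map_poly f p * map_poly f r"
    by (intro poly_eqI)
      (simp add: coeff_map_poly map_zero coeff_mult map_sum map_mult mult_mem)
qed (auto simp: poly_eq_iff coeff_map_poly map_zero map_one map_add map_mem
      coeff_mult coeff_1 one_mem zero_mem intro!: add_mem sum_mem mult_mem uminus_mem)

end

text \<open>The polynomial with simple roots at the elements of \<open>A\<close> is invariant under \<open>H\<close>, so its coefficients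
  are fixed by \<open>H\<close> and hence by \<open>\<sigma>\<close>; therefore \<open>\<sigma>\<close> maps its roots to its roots.\<close>

lemma fixing_invariants_preserves_orbits:
  fixes K :: "'b::idom set"
  assumes \<sigma>: "subring_endomorphism K \<sigma>"
    and H: "\<And>h. h \<in> H \<Longrightarrow> subring_endomorphism K h"
    and fixes_invariants: "\<And>x. x \<in> K \<Longrightarrow> (\<And>h. h \<in> H \<Longrightarrow> h x = x) \<Longrightarrow> \<sigma> x = x"
    and A: "finite A" "A \<subseteq> K" "\<And>h. h \<in> H \<Longrightarrow> h ` A = A"
    and "a \<in> A"
  shows "\<sigma> a \<in> A"
proof -
  define P where "P = (\<Prod>b\<in> A. [:- b, 1:])"
  have lin: "[:- b, 1:] \<in> {p. \<forall>k. coeff p k \<in> K}" if "b \<in> A" for b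
    using that A(2) \<sigma>
    by (auto simp: coeff_pCons subring_endomorphism.zero_mem subring_endomorphism.one_mem
        intro!: subring_endomorphism.uminus_mem split: nat.splits)
  have map_P: "map_poly g P = (\<Prod>b\<in> A. [:- g b, 1:])" if g: "subring_endomorphism K g" for g
  proof -
    interpret g: subring_endomorphism K g by (fact g)
    interpret gp: subring_endomorphism "{p. \<forall>k. coeff p k \<in> K}" "map_poly g"
      by (fact g.subring_endomorphism_map_poly)
    have "map_poly g P = (\<Prod>b\<in> A. map_poly g [:- b, 1:])"
      unfolding P_def by (rule gp.map_prod) (fact lin)
    also have "\<dots> = (\<Prod>b\<in> A. [:- g b, 1:])"
      using A(2) by (intro prod.cong) (auto simp: map_poly_pCons g.map_uminus g.map_one)
    finally show ?thesis .
  qed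
  have P_mem: "coeff P k \<in> K" for k
  proof -
    interpret sp: subring_endomorphism "{p. \<forall>k. coeff p k \<in> K}" "map_poly \<sigma>"
      using \<sigma> by (rule subring_endomorphism.subring_endomorphism_map_poly)
    show ?thesis using sp.prod_mem[of A "\<lambda>b. [:- b, 1:]"] lin unfolding P_def by blast
  qed
  have "map_poly h P = P" if "h \<in> H" for h
  proof -
    have "inj_on h A"
      using A(1) A(3)[OF that] by (simp add: eq_card_imp_inj_on)
    then have "(\<Prod>b\<in> A. [:- h b, 1:]) = (\<Prod>b\<in>h ` A. [:- b, 1:])"
      by (simp add: prod.reindex)
    then show ?thesis using map_P[OF H[OF that]] A(3)[OF that] by (simp add: P_def)
  qed
  then have "h (coeff P k) = coeff P k" if "h \<in> H" for h k
    using that by (metis coeff_map_poly subring_endomorphism.map_zero[OF H])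
  then have "\<sigma> (coeff P k) = coeff P k" for k
    using fixes_invariants P_mem by blast
  then have "map_poly \<sigma> P = P"
    by (simp add: poly_eq_iff coeff_map_poly subring_endomorphism.map_zero[OF \<sigma>])
  moreover have "poly (map_poly \<sigma> P) (\<sigma> a) = 0"
    using map_P[OF \<sigma>] A(1) \<open>a \<in> A\<close> by (auto simp: poly_prod)
  ultimately have "poly P (\<sigma> a) = 0" by simp
  then show ?thesis
    using A(1) by (auto simp: P_def poly_prod)
qed

section \<open>Open subgroups in the Galois correspondence\<close>

lemma mem_Gal_iff:
  "\<sigma> \<in> carrier (Gal K L) \<longleftrightarrow>
     \<sigma> \<in> Bij K \<and> \<sigma> \<in> Ring.ring_hom (ring_on K) (ring_on K) \<and> (\<forall>x\<in>L. \<sigma> x = x)"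
  by (simp add: Gal_def)

lemma one_Gal: "\<one>\<^bsub>Gal K L\<^esub> = (\<lambda>x\<in>K. x)"
  by (simp add: Gal_def BijGroup_def)

lemma mult_Gal:
  "\<sigma> \<in> carrier (Gal K L) \<Longrightarrow> \<tau> \<in> carrier (Gal K L) \<Longrightarrow> \<sigma> \<otimes>\<^bsub>Gal K L\<^esub> \<tau> = compose K \<sigma> \<tau>"
  by (simp add: Gal_def BijGroup_def)

lemma group_Gal:
  assumes K: "subring K ring_of_type_algebra" and L: "L \<subseteq> K"
  shows "group (Gal K L)"
proof -
  have closed: "x + y \<in> K" "x * y \<in> K" "1 \<in> K" if "x \<in> K" "y \<in> K" for x y
    using K that subringE(3,6,7)[OF K] by (simp_all add: ring_of_type_algebra_def)
  interpret B: group "BijGroup K" by (rule group_BijGroup)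
  have "subgroup (carrier (Gal K L)) (BijGroup K)"
  proof (rule subgroup.intro)
    show "carrier (Gal K L) \<subseteq> carrier (BijGroup K)"
      by (auto simp: mem_Gal_iff BijGroup_def)
    show "\<one>\<^bsub>BijGroup K\<^esub> \<in> carrier (Gal K L)"
      using L closed subringE(3)[OF K]
      by (auto simp: mem_Gal_iff BijGroup_def id_Bij Ring.ring_hom_def ring_of_type_algebra_def)
  next
    fix \<sigma> \<tau> assume st: "\<sigma> \<in> carrier (Gal K L)" "\<tau> \<in> carrier (Gal K L)"
    then show "\<sigma> \<otimes>\<^bsub>BijGroup K\<^esub> \<tau> \<in> carrier (Gal K L)"
      using L closed subringE(3)[OF K]
      by (auto simp: mem_Gal_iff BijGroup_def compose_Bij Ring.ring_hom_def ring_of_type_algebra_def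
          Pi_iff subset_iff compose_eq)
  next
    fix \<sigma> assume \<sigma>: "\<sigma> \<in> carrier (Gal K L)"
    define g where "g = inv_into K \<sigma>"
    have bij: "bij_betw \<sigma> K K" and B: "\<sigma> \<in> Bij K" using \<sigma> by (auto simp: mem_Gal_iff Bij_def)
    have g: "g x \<in> K" "\<sigma> (g x) = x" if "x \<in> K" for x
      using that bij unfolding g_def by (auto simp: bij_betw_def inv_into_into f_inv_into_f)
    have gI: "g y = x" if "x \<in> K" "\<sigma> x = y" for x y
      using that bij unfolding g_def by (auto simp: bij_betw_def)
    have h: "\<sigma> (x + y) = \<sigma> x + \<sigma> y" "\<sigma> (x * y) = \<sigma> x * \<sigma> y" "\<sigma> 1 = 1" if "x \<in> K" "y \<in> K" for x y
      using \<sigma> that by (auto simp: mem_Gal_iff Ring.ring_hom_def ring_of_type_algebra_def)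
    have "g (x + y) = g x + g y" "g (x * y) = g x * g y" "g 1 = 1" if "x \<in> K" "y \<in> K" for x y
      using that by (auto intro!: gI simp: closed h g)
    moreover have "g x = x" if "x \<in> L" for x
      using that L \<sigma> by (intro gI) (auto simp: mem_Gal_iff)
    ultimately have "restrict g K \<in> carrier (Gal K L)"
      using g closed L restrict_inv_into_Bij[OF B] subringE(3)[OF K]
      by (auto simp: mem_Gal_iff Ring.ring_hom_def ring_of_type_algebra_def g_def)
    then show "inv\<^bsub>BijGroup K\<^esub> \<sigma> \<in> carrier (Gal K L)"
      by (simp add: inv_BijGroup[OF B] g_def)
  qed
  then have "group ((BijGroup K)\<lparr>carrier := carrier (Gal K L)\<rparr>)"
    by (rule B.subgroup_imp_group)
  then show ?thesis by (simp add: Gal_def)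
qed

lemma Gal_subring_endomorphism:
  assumes K: "subring K ring_of_type_algebra" and "\<sigma> \<in> carrier (Gal K L)"
  shows "subring_endomorphism K \<sigma>"
  using assms(2) subringE(3,5,6,7)[OF K]
proof unfold_locales
  fix x assume x: "x \<in> K"
  interpret R: ring "ring_of_type_algebra :: 'a ring" by (rule ring_from_type_algebra)
  have "\<ominus>\<^bsub>ring_of_type_algebra\<^esub> x = - x"
    by (rule R.minus_equality) (auto simp: ring_of_type_algebra_def)
  then show "- x \<in> K" using subringE(5)[OF K x] by simp
qed (auto simp: mem_Gal_iff Ring.ring_hom_def ring_of_type_algebra_def)

text \<open>The conjugates of \<open>x\<close> over the base field are among the roots of one polynomial.\<close>

lemma finite_Gal_orbit:
  fixes K :: "'a::field alg_closure set"
  assumes K: "subring K ring_of_type_algebra" "base_field \<subseteq> K" and x: "x \<in> K"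
  shows "finite ((\<lambda>\<sigma>. \<sigma> x) ` carrier (Gal K base_field))"
proof -
  obtain p :: "'a poly" where p: "p \<noteq> 0" "poly (map_poly to_ac p) x = 0"
    using alg_closure_algebraic[of x] by blast
  let ?p = "map_poly to_ac p"
  have "poly ?p (\<sigma> x) = 0" if \<sigma>: "\<sigma> \<in> carrier (Gal K base_field)" for \<sigma>
  proof -
    interpret subring_endomorphism K \<sigma>
      using K(1) \<sigma> by (rule Gal_subring_endomorphism)
    have "map_poly \<sigma> ?p = ?p"
      using \<sigma> by (auto simp: poly_eq_iff coeff_map_poly map_zero mem_Gal_iff)
    then show ?thesis
      using map_poly_eval[of ?p x] p x K(2) by (simp add: coeff_map_poly map_zero image_subset_iff)
  qed
  then have "(\<lambda>\<sigma>. \<sigma> x) ` carrier (Gal K base_field) \<subseteq> {y. poly ?p y = 0}" by blast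
  moreover have "?p \<noteq> 0" using p(1) by (simp add: map_poly_eq_0_iff)
  ultimately show ?thesis using poly_roots_finite finite_subset by blast
qed

text \<open>A basis of \<open>L\<close> serves as \<open>S\<close>: an automorphism fixing it fixes all its linear combinations.\<close>

lemma finite_dimension_obtains_rigid_set:
  fixes K :: "'a::field alg_closure set"
  assumes K: "subring K ring_of_type_algebra" "base_field \<subseteq> K" "L \<subseteq> K"
    and fin: "ring.finite_dimension ring_of_type_algebra base_field L"
  obtains S where "finite S" "S \<subseteq> L"
    "\<forall>\<sigma>\<in>carrier (Gal K base_field). (\<forall>s\<in>S. \<sigma> s = s) \<longrightarrow> (\<forall>x\<in>L. \<sigma> x = x)"
proof -
  interpret R: ring "ring_of_type_algebra :: 'a alg_closure ring"
    by (rule ring_from_type_algebra)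
  obtain m where "R.dimension m base_field L"
    using fin by (auto simp: R.finite_dimension_def)
  then have "0 \<in> L \<and> (L \<subseteq> K \<longrightarrow> (\<exists>S. finite S \<and> S \<subseteq> L \<and>
    (\<forall>\<sigma>\<in>carrier (Gal K base_field). (\<forall>s\<in>S. \<sigma> s = s) \<longrightarrow> (\<forall>x\<in>L. \<sigma> x = x))))"
  proof (induction m "base_field :: 'a alg_closure set" L rule: R.dimension.induct)
    case zero_dim
    then show ?case by (auto simp: ring_of_type_algebra_def intro!: exI[of _ "{0}"])
  next
    case (Suc_dim w E d)
    have mem: "x \<in> R.line_extension base_field w E \<longleftrightarrow> (\<exists>a. \<exists>e\<in>E. x = to_ac a * w + e)" for x
      unfolding R.line_extension_mem_iff by (auto simp: ring_of_type_algebra_def)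
    have E: "0 \<in> E" using Suc_dim.hyps by blast
    have "e \<in> R.line_extension base_field w E" if "e \<in> E" for e
      unfolding mem using that by (intro exI[of _ 0] bexI[of _ e]) simp_all
    moreover have "w \<in> R.line_extension base_field w E"
      unfolding mem using E by (intro exI[of _ 1] bexI[of _ 0]) simp_all
    ultimately have sub: "E \<subseteq> R.line_extension base_field w E" "w \<in> R.line_extension base_field w E"
      by blast+
    show ?case
    proof (intro conjI impI)
      show "0 \<in> R.line_extension base_field w E" using E sub by blast
      assume LK: "R.line_extension base_field w E \<subseteq> K"
      then obtain S where S: "finite S" "S \<subseteq> E"
        "\<And>\<sigma>. \<sigma> \<in> carrier (Gal K base_field) \<Longrightarrow> \<forall>s\<in>S. \<sigma> s = s \<Longrightarrow> \<forall>x\<in>E. \<sigma> x = x"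
        using Suc_dim.hyps sub(1) by (meson order_trans)
      have "\<sigma> x = x" if \<sigma>: "\<sigma> \<in> carrier (Gal K base_field)" and fixed: "\<forall>s\<in>insert w S. \<sigma> s = s"
        and x: "x \<in> R.line_extension base_field w E" for \<sigma> x
      proof -
        interpret subring_endomorphism K \<sigma>
          using K(1) \<sigma> by (rule Gal_subring_endomorphism)
        obtain a e where ae: "e \<in> E" "x = to_ac a * w + e" using x mem by blast
        moreover have "to_ac a \<in> K" "w \<in> K" "e \<in> K" using K(2) LK sub ae by auto
        moreover have "\<sigma> (to_ac a) = to_ac a" using \<sigma> by (simp add: mem_Gal_iff)
        moreover have "\<sigma> w = w" "\<sigma> e = e" using fixed S(3)[OF \<sigma>] ae by auto
        ultimately show "\<sigma> x = x" by (simp add: map_add map_mult mult_mem)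
      qed
      moreover have "finite (insert w S)" "insert w S \<subseteq> R.line_extension base_field w E"
        using S(1,2) sub by blast+
      ultimately show "\<exists>S. finite S \<and> S \<subseteq> R.line_extension base_field w E \<and>
        (\<forall>\<sigma>\<in>carrier (Gal K base_field). (\<forall>s\<in>S. \<sigma> s = s) \<longrightarrow>
           (\<forall>x\<in>R.line_extension base_field w E. \<sigma> x = x))"
        by (intro exI[of _ "insert w S"] conjI ballI impI)
    qed
  qed
  then have "\<exists>S. finite S \<and> S \<subseteq> L \<and>
    (\<forall>\<sigma>\<in>carrier (Gal K base_field). (\<forall>s\<in>S. \<sigma> s = s) \<longrightarrow> (\<forall>x\<in>L. \<sigma> x = x))"
    using K(3) by simp
  then show ?thesis by (elim exE conjE that)
qed

lemma Gal_antimono: "L \<subseteq> M \<Longrightarrow> carrier (Gal K M) \<subseteq> carrier (Gal K L)"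
  by (auto simp: mem_Gal_iff subset_iff)

text \<open>Only a coset of \<^term>\<open>Gal K L\<close> that equals \<^term>\<open>Gal K L\<close> itself contains the identity, and each such
  group contains the stabiliser of a finite set; finite intersections correspond to unions of these
  finite sets.\<close>

lemma krull_neighbourhood_of_one:
  fixes K :: "'a::field alg_closure set"
  assumes K: "subring K ring_of_type_algebra" "base_field \<subseteq> K"
    and V: "openin (krull_topology K) V" "\<one>\<^bsub>Gal K base_field\<^esub> \<in> V"
  obtains S where "finite S" "S \<subseteq> K"
    "\<forall>\<sigma>\<in>carrier (Gal K base_field). (\<forall>s\<in>S. \<sigma> s = s) \<longrightarrow> \<sigma> \<in> V"
proof -
  let ?G = "Gal K base_field"
  interpret G: group ?G using K by (rule group_Gal)
  have "\<one>\<^bsub>?G\<^esub> \<in> V \<longrightarrow> (\<exists>S. finite S \<and> S \<subseteq> K \<and> (\<forall>\<sigma>\<in>carrier ?G. (\<forall>s\<in>S. \<sigma> s = s) \<longrightarrow> \<sigma> \<in> V))"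
    using openin_topology_generated_by[OF V(1)[unfolded krull_topology_def]]
  proof induction
    case Empty
    then show ?case by simp
  next
    case (Int a b)
    show ?case
    proof
      assume "\<one>\<^bsub>?G\<^esub> \<in> a \<inter> b"
      then obtain S S' where
        "finite S" "S \<subseteq> K" "\<forall>\<sigma>\<in>carrier ?G. (\<forall>s\<in>S. \<sigma> s = s) \<longrightarrow> \<sigma> \<in> a"
        "finite S'" "S' \<subseteq> K" "\<forall>\<sigma>\<in>carrier ?G. (\<forall>s\<in>S'. \<sigma> s = s) \<longrightarrow> \<sigma> \<in> b"
        using Int.IH by blast
      then show "\<exists>S. finite S \<and> S \<subseteq> K \<and> (\<forall>\<sigma>\<in>carrier ?G. (\<forall>s\<in>S. \<sigma> s = s) \<longrightarrow> \<sigma> \<in> a \<inter> b)"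
        by (intro exI[of _ "S \<union> S'"] conjI ballI impI) simp_all
    qed
  next
    case (UN C)
    show ?case
    proof
      assume "\<one>\<^bsub>?G\<^esub> \<in> \<Union>C"
      then obtain k where k: "k \<in> C" "\<one>\<^bsub>?G\<^esub> \<in> k" by (elim UnionE)
      obtain S where "finite S" "S \<subseteq> K" "\<forall>\<sigma>\<in>carrier ?G. (\<forall>s\<in>S. \<sigma> s = s) \<longrightarrow> \<sigma> \<in> k"
        using UN.IH[OF k(1)] k(2) by (elim impE exE conjE) auto
      then show "\<exists>S. finite S \<and> S \<subseteq> K \<and> (\<forall>\<sigma>\<in>carrier ?G. (\<forall>s\<in>S. \<sigma> s = s) \<longrightarrow> \<sigma> \<in> \<Union>C)"
        using k(1) by (intro exI[of _ S] conjI ballI impI) auto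
    qed
  next
    case (Basis V)
    then obtain \<tau> L where V: "V = \<tau> <#\<^bsub>?G\<^esub> carrier (Gal K L)" and \<tau>: "\<tau> \<in> carrier ?G"
      and L: "intermediate_field K L" and fin: "ring.finite_dimension ring_of_type_algebra base_field L"
      by blast
    have LK: "base_field \<subseteq> L" "L \<subseteq> K" using L by (auto simp: intermediate_field_def)
    obtain S where S: "finite S" "S \<subseteq> L"
      "\<forall>\<sigma>\<in>carrier ?G. (\<forall>s\<in>S. \<sigma> s = s) \<longrightarrow> (\<forall>x\<in>L. \<sigma> x = x)"
      by (rule finite_dimension_obtains_rigid_set[OF K LK(2) fin])
    show ?case
    proof
      assume "\<one>\<^bsub>?G\<^esub> \<in> V"
      then obtain g where g: "g \<in> carrier (Gal K L)" "\<one>\<^bsub>?G\<^esub> = \<tau> \<otimes>\<^bsub>?G\<^esub> g"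
        by (auto simp: V l_coset_def)
      have gG: "g \<in> carrier ?G" using g(1) Gal_antimono[OF LK(1)] by blast
      have "\<sigma> \<in> V" if \<sigma>: "\<sigma> \<in> carrier ?G" "\<forall>s\<in>S. \<sigma> s = s" for \<sigma>
      proof -
        have "\<sigma> x = x" if "x \<in> L" for x using S(3) \<sigma> that by blast
        then have "\<sigma> \<in> carrier (Gal K L)"
          using \<sigma>(1) by (simp add: mem_Gal_iff)
        moreover have "g \<otimes>\<^bsub>?G\<^esub> \<sigma> = g \<otimes>\<^bsub>Gal K L\<^esub> \<sigma>" by (simp add: Gal_def)
        moreover have "group (Gal K L)" using K(1) LK(2) by (rule group_Gal)
        ultimately have "g \<otimes>\<^bsub>?G\<^esub> \<sigma> \<in> carrier (Gal K L)"
          using g(1) by (simp add: group.is_monoid monoid.m_closed)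
        moreover have "\<sigma> = \<tau> \<otimes>\<^bsub>?G\<^esub> (g \<otimes>\<^bsub>?G\<^esub> \<sigma>)"
          using g(2) gG \<tau> \<sigma>(1) by (metis G.l_one G.m_assoc)
        ultimately show "\<sigma> \<in> V" by (auto simp: V l_coset_def)
      qed
      then show "\<exists>S. finite S \<and> S \<subseteq> K \<and> (\<forall>\<sigma>\<in>carrier ?G. (\<forall>s\<in>S. \<sigma> s = s) \<longrightarrow> \<sigma> \<in> V)"
        using S(1,2) LK(2) by (intro exI[of _ S] conjI ballI impI) auto
    qed
  qed
  then have "\<exists>S. finite S \<and> S \<subseteq> K \<and>
    (\<forall>\<sigma>\<in>carrier ?G. (\<forall>s\<in>S. \<sigma> s = s) \<longrightarrow> \<sigma> \<in> V)"
    using V(2) by (rule mp)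
  then show ?thesis by (elim exE conjE that)
qed

text \<open>The half of the Galois correspondence that the theorem rests on. Openness reduces the claim to finding
  an element of \<open>H\<close> that agrees with \<open>\<sigma>\<close> on a finite set \<open>S\<close>. Taking the elements of \<open>S\<close> as
  the coefficients of a single polynomial \<open>f\<close> turns this into a statement about the \<open>H\<close>-orbit of \<open>f\<close>.\<close>

lemma open_subgroup_contains_stabiliser_of_fixed_field:
  fixes K :: "'a::field alg_closure set"
  assumes K: "subring K ring_of_type_algebra" "base_field \<subseteq> K"
    and H: "subgroup H (Gal K base_field)" "openin (krull_topology K) H"
    and \<sigma>: "\<sigma> \<in> carrier (Gal K base_field)" "\<And>x. x \<in> fixed_field K H \<Longrightarrow> \<sigma> x = x"
  shows "\<sigma> \<in> H"
proof -
  let ?G = "Gal K base_field" and ?KX = "{p. \<forall>k. coeff p k \<in> K}"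
  interpret G: group ?G using K by (rule group_Gal)
  interpret H: subgroup H ?G by (fact H(1))
  have endo: "subring_endomorphism K \<tau>" if "\<tau> \<in> carrier ?G" for \<tau>
    using K(1) that by (rule Gal_subring_endomorphism)
  have coeff_map: "coeff (map_poly \<tau> p) k = \<tau> (coeff p k)" if "\<tau> \<in> carrier ?G" for \<tau> p k
    by (simp add: coeff_map_poly subring_endomorphism.map_zero[OF endo[OF that]])
  have mult_apply: "(\<tau> \<otimes>\<^bsub>?G\<^esub> \<tau>') x = \<tau> (\<tau>' x)"
    if "\<tau> \<in> carrier ?G" "\<tau>' \<in> carrier ?G" "x \<in> K" for \<tau> \<tau>' x
    using that by (simp add: mult_Gal compose_eq)
  have inv_apply: "(inv\<^bsub>?G\<^esub> \<tau>) (\<tau> x) = x" "\<tau> ((inv\<^bsub>?G\<^esub> \<tau>) x) = x"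
    if "\<tau> \<in> carrier ?G" "x \<in> K" for \<tau> x
    using mult_apply[of "inv\<^bsub>?G\<^esub> \<tau>" \<tau> x] mult_apply[of \<tau> "inv\<^bsub>?G\<^esub> \<tau>" x] that
    by (simp_all add: one_Gal)
  have H_carrier: "h \<in> carrier ?G" if "h \<in> H" for h using that H.subset by blast
  obtain S where S: "finite S" "S \<subseteq> K"
    "\<forall>\<tau>\<in>carrier ?G. (\<forall>s\<in>S. \<tau> s = s) \<longrightarrow> \<tau> \<in> H"
    by (rule krull_neighbourhood_of_one[OF K H(2) H.one_closed])
  obtain xs where xs: "set xs = S" using S(1) finite_list by blast
  \<comment> \<open>Two automorphisms agree on \<open>S\<close> if and only if they map \<open>f\<close> to the same polynomial.\<close>
  define f where "f = Poly xs"
  define A where "A = (\<lambda>h. map_poly h f) ` H"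
  have f: "f \<in> ?KX"
    using xs S(2) subring_endomorphism.zero_mem[OF endo[OF \<sigma>(1)]]
    by (auto simp: f_def nth_default_def)
  have "finite A"
  proof (rule finite_subset)
    define B where "B = (\<Union>s\<in>S. (\<lambda>\<tau>. \<tau> s) ` carrier ?G)"
    have "finite B" unfolding B_def using S K by (auto intro!: finite_Gal_orbit)
    then show "finite (Poly ` {ys. set ys \<subseteq> B \<and> length ys = length xs})"
      by (intro finite_imageI finite_lists_length_eq)
    have "map_poly h f = Poly (map h xs)" if "h \<in> H" for h
      using subring_endomorphism.map_zero[OF endo[OF H_carrier[OF that]]]
      by (simp add: poly_eq_iff coeff_map[OF H_carrier[OF that]] f_def nth_default_def)
    moreover have "set (map h xs) \<subseteq> B" if "h \<in> H" for h
      using that H_carrier xs by (auto simp: B_def)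
    ultimately show "A \<subseteq> Poly ` {ys. set ys \<subseteq> B \<and> length ys = length xs}"
      by (auto simp: A_def)
  qed
  have map_mult: "map_poly h (map_poly h' f) = map_poly (h \<otimes>\<^bsub>?G\<^esub> h') f" if "h \<in> H" "h' \<in> H" for h h'
    using that f by (simp add: poly_eq_iff coeff_map H_carrier mult_apply)
  have "map_poly h ` A = A" if h: "h \<in> H" for h
  proof
    show "map_poly h ` A \<subseteq> A"
      using h map_mult by (auto simp: A_def)
    show "A \<subseteq> map_poly h ` A"
    proof
      fix p assume "p \<in> A"
      then obtain h' where h': "h' \<in> H" "p = map_poly h' f" by (auto simp: A_def)
      have "h' = h \<otimes>\<^bsub>?G\<^esub> (inv\<^bsub>?G\<^esub> h \<otimes>\<^bsub>?G\<^esub> h')"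
        using h h' H_carrier by (simp add: G.m_assoc[symmetric])
      then have "p = map_poly h (map_poly (inv\<^bsub>?G\<^esub> h \<otimes>\<^bsub>?G\<^esub> h') f)"
        using h h' map_mult by simp
      then show "p \<in> map_poly h ` A"
        using h h' by (simp add: A_def)
    qed
  qed
  moreover have "f \<in> A"
  proof -
    have "\<one>\<^bsub>?G\<^esub> x = x" if "x \<in> K" for x using that by (simp add: one_Gal)
    then have "map_poly \<one>\<^bsub>?G\<^esub> f = f"
      using f by (simp add: poly_eq_iff coeff_map)
    then show ?thesis unfolding A_def by (rule image_eqI[OF sym H.one_closed])
  qed
  moreover have "A \<subseteq> ?KX"
    unfolding A_def
    using subring_endomorphism.map_mem[OF subring_endomorphism.subring_endomorphism_map_poly f]
      endo[OF H_carrier] by blast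
  moreover have "map_poly \<sigma> p = p" if p: "p \<in> ?KX" "\<And>g. g \<in> map_poly ` H \<Longrightarrow> g p = p" for p
  proof -
    have "h (coeff p k) = coeff p k" if "h \<in> H" for h k
      using coeff_map[OF H_carrier[OF that], of p k] p(2)[OF imageI[OF that]] by simp
    then have "coeff p k \<in> fixed_field K H" for k
      using p(1) by (simp add: fixed_field_def)
    then have "\<sigma> (coeff p k) = coeff p k" for k by (rule \<sigma>(2))
    then show ?thesis
      by (simp add: poly_eq_iff coeff_map[OF \<sigma>(1)])
  qed
  ultimately have "map_poly \<sigma> f \<in> A"
  proof (intro fixing_invariants_preserves_orbits[of ?KX "map_poly \<sigma>" "map_poly ` H" A f])
    show "subring_endomorphism ?KX (map_poly \<sigma>)"
      using \<sigma>(1) by (intro subring_endomorphism.subring_endomorphism_map_poly endo)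
    show "subring_endomorphism ?KX g" if "g \<in> map_poly ` H" for g
      using that by (auto intro: subring_endomorphism.subring_endomorphism_map_poly endo H_carrier)
  qed (use \<open>finite A\<close> in auto)
  then obtain h where h: "h \<in> H" and eq: "map_poly \<sigma> f = map_poly h f" by (auto simp: A_def)
  have agree: "\<sigma> s = h s" if "s \<in> S" for s
  proof -
    obtain k where "k < length xs" "xs ! k = s" using \<open>s \<in> S\<close> xs by (metis in_set_conv_nth)
    then have "coeff f k = s" by (simp add: f_def nth_default_def)
    then show ?thesis
      using eq coeff_map[OF \<sigma>(1)] coeff_map[OF H_carrier[OF h]] by metis
  qed
  have "inv\<^bsub>?G\<^esub> h \<otimes>\<^bsub>?G\<^esub> \<sigma> \<in> H"
  proof (rule S(3)[THEN bspec, THEN mp])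
    show "inv\<^bsub>?G\<^esub> h \<otimes>\<^bsub>?G\<^esub> \<sigma> \<in> carrier ?G" using h \<sigma>(1) H_carrier by simp
    show "\<forall>s\<in>S. (inv\<^bsub>?G\<^esub> h \<otimes>\<^bsub>?G\<^esub> \<sigma>) s = s"
      using agree S(2) h \<sigma>(1) H_carrier by (simp add: mult_apply inv_apply subset_iff)
  qed
  then have "h \<otimes>\<^bsub>?G\<^esub> (inv\<^bsub>?G\<^esub> h \<otimes>\<^bsub>?G\<^esub> \<sigma>) \<in> H" using h by blast
  then show ?thesis using h \<sigma>(1) H_carrier by (simp add: G.m_assoc[symmetric])
qed

section \<open>The Krull topology and the quotient topology\<close>

lemma subfield_base_field:
  "subfield (base_field :: 'a::field alg_closure set) ring_of_type_algebra"
proof -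
  interpret F: Ring.field "ring_of_type_algebra :: 'a alg_closure ring"
    by (rule field_from_type_algebra)
  have uminus: "\<ominus>\<^bsub>ring_of_type_algebra\<^esub> x = - x" for x :: "'a alg_closure"
    by (rule F.minus_equality) (auto simp: ring_of_type_algebra_def)
  have "subring base_field (ring_of_type_algebra :: 'a alg_closure ring)"
  proof (rule F.subringI)
    show "\<ominus>\<^bsub>ring_of_type_algebra\<^esub> h \<in> base_field" if "h \<in> base_field" for h :: "'a alg_closure"
      using that unfolding uminus by (auto simp flip: to_ac_minus)
  qed (auto simp: ring_of_type_algebra_def simp flip: to_ac_1 to_ac_mult to_ac_add)
  then have "subcring base_field (ring_of_type_algebra :: 'a alg_closure ring)"
    by (rule F.subcringI')
  moreover have "Units (ring_on base_field) = base_field - {0 :: 'a alg_closure}"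
  proof (intro equalityI subsetI)
    fix x :: "'a alg_closure" assume "x \<in> base_field - {0}"
    then obtain a where a: "x = to_ac a" "a \<noteq> 0" by auto
    then have "to_ac (inverse a) * x = 1" "x * to_ac (inverse a) = 1"
      by (simp_all flip: to_ac_mult)
    then show "x \<in> Units (ring_on base_field)"
      using a unfolding Units_def by (auto simp: ring_of_type_algebra_def simp del: to_ac_inverse)
  qed (auto simp: Units_def ring_of_type_algebra_def)
  ultimately show ?thesis
    by (intro F.subfieldI) (simp_all add: ring_of_type_algebra_def)
qed

lemma topspace_krull_topology:
  assumes K: "subring K ring_of_type_algebra" "base_field \<subseteq> K"
  shows "topspace (krull_topology K) = carrier (Gal K base_field)"
proof -
  let ?G = "Gal K base_field"
  interpret R: ring "ring_of_type_algebra :: 'a alg_closure ring"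
    by (rule ring_from_type_algebra)
  interpret G: group ?G using K by (rule group_Gal)
  have "\<tau> <#\<^bsub>?G\<^esub> carrier (Gal K L) \<subseteq> carrier ?G"
    if "\<tau> \<in> carrier ?G" "intermediate_field K L" for \<tau> L
    using that Gal_antimono[of base_field L K]
    by (intro G.l_coset_subset_G) (auto simp: intermediate_field_def)
  moreover have "\<tau> \<in> \<tau> <#\<^bsub>?G\<^esub> carrier ?G" if "\<tau> \<in> carrier ?G" for \<tau>
    using that G.r_one G.one_closed unfolding l_coset_def by force
  moreover have "intermediate_field K base_field"
    using K subfield_base_field by (simp add: intermediate_field_def)
  moreover have "R.finite_dimension base_field base_field"
    using R.dimension_one[OF subfield_base_field] by (rule R.finite_dimensionI)
  ultimately show ?thesis
    unfolding krull_topology_def topology_generated_by_topspace by blast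
qed

text \<open>The whole group is one of the sets being intersected; the intersection of an empty family would not
  be a subset of the group.\<close>

lemma closed_normal_closure_normal:
  assumes "group G" and Tp: "topspace Tp = carrier G" and S: "S \<subseteq> carrier G"
  shows "closed_normal_closure G Tp S \<lhd> G"
proof -
  interpret group G by fact
  let ?F = "{H. H \<lhd> G \<and> closedin Tp H \<and> S \<subseteq> H}"
  have "carrier G \<lhd> G"
    by (simp add: normal_inv_iff subgroup_self)
  then have "carrier G \<in> ?F"
    using S closedin_topspace[of Tp] Tp by simp
  then have "subgroup (\<Inter>?F) G"
    by (intro subgroups_Inter) (auto simp: normal_inv_iff)
  then show ?thesis
    unfolding closed_normal_closure_def by (auto simp: normal_inv_iff)
qed

text \<open>The generating sets of the quotient topology already form a topology: since distinct cosets are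
  disjoint, taking the union of a family of cosets commutes with intersections of families.\<close>

lemma openin_quotient_group_topology:
  assumes "group G" "subgroup N G" and W: "openin (quotient_group_topology G Tp N) W"
  shows "W \<subseteq> carrier (G Mod N) \<and> openin Tp (\<Union>W)"
  using openin_topology_generated_by[OF W[unfolded quotient_group_topology_def]]
proof induction
  case (Int a b)
  have "C = D" if "C \<in> a" "D \<in> b" "x \<in> C" "x \<in> D" for C D x
    using that Int.IH group.rcos_disjoint[OF assms(1,2)]
    by (auto simp: FactGroup_def pairwise_def disjnt_def)
  then have "\<Union>(a \<inter> b) = \<Union>a \<inter> \<Union>b" by blast
  then show ?case using Int.IH by auto
next
  case (UN C)
  then have "openin Tp (\<Union>k\<in>C. \<Union>k)" by blast
  moreover have "(\<Union>k\<in>C. \<Union>k) = \<Union>(\<Union>C)" by blast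
  moreover have "\<Union>C \<subseteq> carrier (G Mod N)" using UN.IH by blast
  ultimately show ?case by simp
qed auto

section \<open>Kernels of unipotent representations\<close>

text \<open>The image of the identity is idempotent, so the absence of further idempotents can take the place of
  the cancellation law in \<open>M\<close>.\<close>

lemma kernel_subgroup:
  assumes "group G" "\<phi> \<in> hom G M"
    and idem: "\<And>e. e \<in> carrier M \<Longrightarrow> e \<otimes>\<^bsub>M\<^esub> e = e \<Longrightarrow> e = \<one>\<^bsub>M\<^esub>"
    and M_l_one: "\<And>e. e \<in> carrier M \<Longrightarrow> \<one>\<^bsub>M\<^esub> \<otimes>\<^bsub>M\<^esub> e = e"
  shows "subgroup (kernel G M \<phi>) G"
proof -
  interpret group G by fact
  have mem: "\<phi> x \<in> carrier M" if "x \<in> carrier G" for x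
    using assms(2) that by (rule hom_in_carrier)
  have mult: "\<phi> (x \<otimes>\<^bsub>G\<^esub> y) = \<phi> x \<otimes>\<^bsub>M\<^esub> \<phi> y" if "x \<in> carrier G" "y \<in> carrier G" for x y
    using assms(2) that by (rule hom_mult)
  have one: "\<phi> \<one>\<^bsub>G\<^esub> = \<one>\<^bsub>M\<^esub>"
    using mult[of "\<one>\<^bsub>G\<^esub>" "\<one>\<^bsub>G\<^esub>"] by (intro idem) (simp_all add: mem)
  have inv: "\<phi> (inv\<^bsub>G\<^esub> x) = \<one>\<^bsub>M\<^esub>" if x: "x \<in> carrier G" "\<phi> x = \<one>\<^bsub>M\<^esub>" for x
    using mult[of x "inv\<^bsub>G\<^esub> x"] M_l_one[OF mem, of "inv\<^bsub>G\<^esub> x"] x one by simp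
  show ?thesis
    by (rule subgroup.intro) (auto simp: kernel_def mult one inv M_l_one mem[OF one_closed, unfolded one])
qed

text \<open>A unipotent matrix has determinant \<open>1\<close>, so over any commutative ring its adjugate is an inverse, and
  one factor of \<open>A * A = A\<close> can be cancelled.\<close>

lemma unipotent_idempotent_eq_one:
  assumes A: "A \<in> carrier (unipotent_group n)" and idem: "A * A = A"
  shows "A = 1\<^sub>m (n + 1)"
proof -
  have C: "A \<in> carrier_mat (n + 1) (n + 1)" and ut: "upper_triangular A"
    and diag: "\<forall>i\<le>n. A $$ (i, i) = 1"
    using A by (auto simp: unipotent_group_def)
  have "diag_mat A = map (\<lambda>_. 1) [0..<n + 1]"
    using C diag unfolding diag_mat_def by (intro map_cong) auto
  then have "det A = 1"
    using det_upper_triangular[OF ut C] by (simp add: map_replicate_const)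
  then have inv: "adj_mat A * A = 1\<^sub>m (n + 1)" "adj_mat A \<in> carrier_mat (n + 1) (n + 1)"
    using adj_mat[OF C] by auto
  have "A = (adj_mat A * A) * A" using inv C by simp
  also have "\<dots> = adj_mat A * (A * A)" using inv(2) C by simp
  also have "\<dots> = 1\<^sub>m (n + 1)" using idem inv by simp
  finally show ?thesis .
qed

lemma corner_subgroup_eq_one_iff:
  assumes "A \<in> corner_subgroup n" "n \<ge> 1"
  shows "A = \<one>\<^bsub>unipotent_group n\<^esub> \<longleftrightarrow> A $$ (0, n) = 0"
proof -
  obtain r where r: "A = elementary_unipotent n 1 (n + 1) r"
    using assms(1) by (auto simp: corner_subgroup_def)
  have "A $$ (0, n) = r" using assms(2) by (simp add: r elementary_unipotent_def)
  moreover have "A = 1\<^sub>m (n + 1)" if "r = 0"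
    using that by (intro eq_matI) (auto simp: r elementary_unipotent_def)
  moreover have "1\<^sub>m (n + 1) $$ (0, n) = (0 :: 'a)" using assms(2) by simp
  ultimately show ?thesis by (auto simp: unipotent_group_def)
qed

text \<open>The singleton of the identity matrix is open in the discrete topology, and \<open>H\<close> is the union of the cosets
  in its preimage under \<open>\<rho>\<close>.\<close>

lemma unipotent_kernel_open_subgroup:
  assumes G: "group G" and N: "N \<lhd> G" and Tp: "topspace Tp = carrier G"
    and hom: "\<rho> \<in> hom (G Mod N) (unipotent_group n)"
    and cont: "continuous_map (quotient_group_topology G Tp N)
      (discrete_topology (carrier (unipotent_group n))) \<rho>"
  defines "H \<equiv> kernel G (unipotent_group n) (\<lambda>\<sigma>. \<rho> (N #>\<^bsub>G\<^esub> \<sigma>))"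
  shows "subgroup H G" "openin Tp H"
proof -
  let ?U = "unipotent_group n" and ?X = "quotient_group_topology G Tp N"
  interpret G: group G by fact
  have NG: "subgroup N G" using N by (rule normal_imp_subgroup)
  have "\<rho> \<circ> (\<lambda>\<sigma>. N #>\<^bsub>G\<^esub> \<sigma>) \<in> hom G ?U"
    using normal.r_coset_hom_Mod[OF N] hom by (rule hom_compose)
  then show "subgroup H G"
    unfolding H_def comp_def
    by (rule kernel_subgroup[OF G])
      (use unipotent_idempotent_eq_one in \<open>auto simp: unipotent_group_def\<close>)
  have union: "\<Union>(carrier (G Mod N)) = carrier G"
    using G.rcosets_part_G[OF NG] by (simp add: FactGroup_def)
  have "openin ?X (carrier (G Mod N))"
    unfolding quotient_group_topology_def
    using union Tp openin_topspace[of Tp] by (intro topology_generated_by_Basis) simp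
  then have X: "topspace ?X = carrier (G Mod N)"
    using openin_quotient_group_topology[OF G NG openin_topspace] openin_subset by blast
  have "\<one>\<^bsub>?U\<^esub> \<in> carrier ?U"
    by (auto simp: unipotent_group_def)
  then have "openin ?X {C \<in> topspace ?X. \<rho> C \<in> {\<one>\<^bsub>?U\<^esub>}}"
    using cont by (intro openin_continuous_map_preimage) auto
  then have "openin Tp (\<Union>{C \<in> carrier (G Mod N). \<rho> C = \<one>\<^bsub>?U\<^esub>})"
    using openin_quotient_group_topology[OF G NG] X by auto
  moreover have "\<Union>{C \<in> carrier (G Mod N). \<rho> C = \<one>\<^bsub>?U\<^esub>} = H"
  proof -
    have coset: "C = N #>\<^bsub>G\<^esub> x" if "C \<in> carrier (G Mod N)" "x \<in> C" for C x
      using that G.repr_independence[OF _ _ NG] by (auto simp: carrier_FactGroup)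
    show ?thesis
    proof (intro equalityI subsetI)
      fix x assume "x \<in> \<Union>{C \<in> carrier (G Mod N). \<rho> C = \<one>\<^bsub>?U\<^esub>}"
      then obtain C where C: "C \<in> carrier (G Mod N)" "\<rho> C = \<one>\<^bsub>?U\<^esub>" "x \<in> C" by blast
      moreover have "x \<in> carrier G" using C union by blast
      ultimately show "x \<in> H" using coset[of C x] by (simp add: H_def kernel_def)
    next
      fix x assume "x \<in> H"
      then have x: "x \<in> carrier G" "\<rho> (N #>\<^bsub>G\<^esub> x) = \<one>\<^bsub>?U\<^esub>" by (simp_all add: H_def kernel_def)
      then have "N #>\<^bsub>G\<^esub> x \<in> carrier (G Mod N)" by (simp add: carrier_FactGroup)
      then show "x \<in> \<Union>{C \<in> carrier (G Mod N). \<rho> C = \<one>\<^bsub>?U\<^esub>}"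
        using x G.rcos_self[OF x(1) NG] by blast
    qed
  qed
  ultimately show "openin Tp H" by simp
qed

section \<open>The linking invariant and complete decomposition\<close>

lemma restrict_eq_restrict_iff: "restrict f A = restrict g A \<longleftrightarrow> (\<forall>x\<in>A. f x = g x)"
  by (metis restrict_apply' restrict_ext)

theorem theorem8p6:
  fixes p q n :: nat
    and Fp :: "'a::field alg_closure set"
    and \<iota> :: "'a \<Rightarrow> 'q::nontriv mod_ring"
    and J_val J_ord J I I_val I_ord I_hat :: "'j set"
    and v :: "'j \<Rightarrow> 'a \<Rightarrow> 'v::linordered_ab_group_add"
    and u :: "'j \<Rightarrow> 'a alg_closure \<Rightarrow> 'v"
    and P :: "'j \<Rightarrow> 'a set"
    and R :: "'j \<Rightarrow> 'a alg_closure set"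
    and G :: "('a alg_closure \<Rightarrow> 'a alg_closure) monoid"
    and Z T :: "'j \<Rightarrow> ('a alg_closure \<Rightarrow> 'a alg_closure) set"
    and i :: "nat \<Rightarrow> 'j"
    and t :: "'j \<Rightarrow> 'a"
    and \<pi> :: "'j \<Rightarrow> ('a alg_closure \<Rightarrow> 'a alg_closure) \<Rightarrow> 'q mod_ring mat"
    and N :: "('a alg_closure \<Rightarrow> 'a alg_closure) set"
    and G_hat :: "('a alg_closure \<Rightarrow> 'a alg_closure) set monoid"
    and X_hat :: "('a alg_closure \<Rightarrow> 'a alg_closure) set topology"
    and res :: "'j \<Rightarrow> ('a alg_closure \<Rightarrow> 'a alg_closure) \<Rightarrow> ('a alg_closure \<Rightarrow> 'a alg_closure) set"
    and \<rho> :: "('a alg_closure \<Rightarrow> 'a alg_closure) set \<Rightarrow> 'q mod_ring mat"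
    and E :: "'a alg_closure set"
    and j :: 'j
  assumes "prime p" and "q > 1" and "\<exists>k. q = p ^ k" and "q = CARD('q)"
    and "\<exists>\<zeta>::'a. \<zeta> ^ q = 1 \<and> (\<forall>k. 0 < k \<and> k < q \<longrightarrow> \<zeta> ^ k \<noteq> 1)"
    and "\<iota> \<in> iso (roots_of_unity_group q) (add_monoid ring_of_type_algebra)"
    and "maximal_pro_p_extension p Fp"
    and "G = Gal Fp base_field"
    \<comment> \<open>valuations and orderings\<close>
    and "J = J_val \<union> J_ord" and "J_val \<inter> J_ord = {}"
    and "\<forall>k\<in>J_val. valuation_on UNIV (v k) \<and> value_group UNIV (v k) \<noteq> {0}"
    and "\<forall>k\<in>J_val. \<forall>l\<in>J_val. k \<noteq> l \<longrightarrow> \<not> equivalent_valuations (v k) (v l)"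
    and "\<forall>k\<in>J_val. valuation_on Fp (u k) \<and> (\<forall>x. x \<noteq> 0 \<longrightarrow> u k (to_ac x) = v k x)"
    and "p \<noteq> 2 \<longrightarrow> J_ord = {}"
    and "\<forall>k\<in>J_ord. field_ordering_on UNIV (P k)" and "inj_on P J_ord"
    and "\<forall>k\<in>J_ord. relative_real_closure Fp (P k) (R k)"
    and "Z = (\<lambda>k. if k \<in> J_val then decomposition_group Fp (u k) else carrier (Gal Fp (R k)))"
    and "T = (\<lambda>k. if k \<in> J_val then inertia_group Fp (u k) else carrier (Gal Fp (R k)))"
    \<comment> \<open>the index set \<open>I\<close> and the local maps\<close>
    and "n \<ge> 1" and "inj_on i {1..n}" and "I = i ` {1..n}" and "I \<subseteq> J"
    and "I_val = I \<inter> J_val" and "I_ord = I \<inter> J_ord"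
    and "\<forall>k\<in>I_val. discrete_valuation (v k) \<and> residue_characteristic (v k) \<noteq> p"
    and "inj_on (\<lambda>k. if k \<in> J_val then valuation_topology (v k) else ordering_topology (P k)) I"
    and "\<forall>k\<in>I. t k \<noteq> 0"
    and "\<forall>k\<in>I_val. uniformizer (v k) (t k)"
    and "\<forall>k\<in>I_ord. - t k \<in> P k"
    and "\<forall>k\<in>I. \<forall>l\<in>I_val. k \<noteq> l \<longrightarrow> v l (t k) = 0"
    and "\<forall>k\<in>I. \<forall>l\<in>I_ord. k \<noteq> l \<longrightarrow> t k \<in> P l"
    and "\<forall>l\<in>{1..n}. \<forall>\<tau>\<in>T (i l).
           \<pi> (i l) \<tau> = elementary_unipotent n l (l + 1) (kummer_map Fp \<iota> (t (i l)) \<tau>)"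
    \<comment> \<open>the Galois group unramified outside \<open>I_hat\<close> and its linking structure\<close>
    and "I \<subseteq> I_hat" and "I_hat \<subseteq> J"
    and "N = closed_normal_closure G (krull_topology Fp) (\<Union>k\<in>J - I_hat. T k)"
    and "G_hat = G Mod N"
    and "X_hat = quotient_group_topology G (krull_topology Fp) N"
    and "res = (\<lambda>k. \<lambda>\<sigma>\<in>Z k. N #>\<^bsub>G\<^esub> \<sigma>)"
    and "X_hat closure_of generate G_hat (\<Union>k\<in>I. res k ` T k) = carrier G_hat"
    and "globalization
           \<lparr>global_group = G_hat, global_topology = X_hat, target_group = unipotent_group n,
            index_set = I, decomposition_at = Z, inertia_at = T, res_at = res, local_map = \<pi>\<rparr> \<rho>"
    and "E = fixed_field Fp (kernel G (unipotent_group n) (\<lambda>\<sigma>. \<rho> (N #>\<^bsub>G\<^esub> \<sigma>)))"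
    and "j \<in> J_val - I_hat"
    and "\<rho> ` res j ` Z j \<subseteq> corner_subgroup n"
  shows "linking_invariant n \<rho> (res j) (Z j) = (\<lambda>\<sigma>\<in>Z j. 0) \<longleftrightarrow> completely_decomposed Fp (u j) E"
proof -
  let ?G = "Gal Fp base_field" and ?U = "unipotent_group n :: 'q mod_ring mat monoid"
  define H where "H = kernel ?G ?U (\<lambda>\<sigma>. \<rho> (N #>\<^bsub>?G\<^esub> \<sigma>))"
  have "intermediate_field UNIV Fp"
    using \<open>maximal_pro_p_extension p Fp\<close>
    by (simp add: maximal_pro_p_extension_def pro_p_galois_extension_def galois_extension_def)
  then have Fp: "subring Fp ring_of_type_algebra" "base_field \<subseteq> Fp"
    by (auto simp: intermediate_field_def dest: subfieldE(1))
  interpret G: group ?G using Fp by (rule group_Gal)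
  have "T k \<subseteq> carrier ?G" if "k \<in> J - I_hat" for k
  proof (cases "k \<in> J_val")
    case True
    then show ?thesis
      using \<open>T = _\<close> by (auto simp: inertia_group_def)
  next
    case False
    then have "relative_real_closure Fp (P k) (R k)"
      using that \<open>J = J_val \<union> J_ord\<close> \<open>\<forall>k\<in>J_ord. relative_real_closure Fp (P k) (R k)\<close> by blast
    then have "base_field \<subseteq> R k"
      by (simp add: relative_real_closure_def ordering_extends_to_def intermediate_field_def)
    then show ?thesis
      using Gal_antimono[of base_field "R k" Fp] False \<open>T = _\<close> by simp
  qed
  then have N: "N \<lhd> ?G"
    unfolding \<open>N = _\<close> \<open>G = _\<close>
    by (intro closed_normal_closure_normal G.is_group topspace_krull_topology[OF Fp]) blast
  have "\<rho> \<in> hom (?G Mod N) ?U"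
    and "continuous_map (quotient_group_topology ?G (krull_topology Fp) N)
           (discrete_topology (carrier ?U)) \<rho>"
    using \<open>globalization _ \<rho>\<close> unfolding \<open>G_hat = _\<close> \<open>X_hat = _\<close> \<open>G = _\<close>
    by (simp_all add: globalization_def)
  note H = unipotent_kernel_open_subgroup[OF G.is_group N topspace_krull_topology[OF Fp] this,
      folded H_def]
  have E: "E = fixed_field Fp H"
    using \<open>E = _\<close> \<open>G = _\<close> by (simp add: H_def)
  have j: "j \<in> J_val" using \<open>j \<in> J_val - I_hat\<close> by blast
  have Z: "Z j = decomposition_group Fp (u j)" using \<open>Z = _\<close> j by simp
  have ZG: "\<sigma> \<in> carrier ?G" if "\<sigma> \<in> Z j" for \<sigma>
    using that by (simp add: Z decomposition_group_def)
  have res: "res j \<sigma> = N #>\<^bsub>?G\<^esub> \<sigma>" if "\<sigma> \<in> Z j" for \<sigma>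
    using that \<open>res = _\<close> \<open>G = _\<close> by simp
  have "linking_invariant n \<rho> (res j) (Z j) = (\<lambda>\<sigma>\<in>Z j. 0) \<longleftrightarrow>
      (\<forall>\<sigma>\<in>Z j. \<rho> (res j \<sigma>) $$ (0, n) = 0)"
    unfolding linking_invariant_def by (rule restrict_eq_restrict_iff)
  also have "\<dots> \<longleftrightarrow> (\<forall>\<sigma>\<in>Z j. \<rho> (res j \<sigma>) = \<one>\<^bsub>?U\<^esub>)"
    using \<open>\<rho> ` res j ` Z j \<subseteq> corner_subgroup n\<close> corner_subgroup_eq_one_iff[OF _ \<open>n \<ge> 1\<close>] by blast
  also have "\<dots> \<longleftrightarrow> Z j \<subseteq> H"
    using ZG by (auto simp: H_def kernel_def res)
  also have "\<dots> \<longleftrightarrow> (\<forall>\<sigma>\<in>Z j. \<forall>x\<in>E. \<sigma> x = x)"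
  proof
    assume "Z j \<subseteq> H"
    then show "\<forall>\<sigma>\<in>Z j. \<forall>x\<in>E. \<sigma> x = x" by (auto simp: E fixed_field_def)
  next
    assume fixes_E: "\<forall>\<sigma>\<in>Z j. \<forall>x\<in>E. \<sigma> x = x"
    show "Z j \<subseteq> H"
    proof
      fix \<sigma> assume "\<sigma> \<in> Z j"
      then show "\<sigma> \<in> H"
        using fixes_E ZG E
        by (intro open_subgroup_contains_stabiliser_of_fixed_field[OF Fp H]) auto
    qed
  qed
  also have "\<dots> \<longleftrightarrow> (\<forall>\<sigma>\<in>Z j. restrict \<sigma> E = (\<lambda>x\<in>E. x))"
    by (simp only: restrict_eq_restrict_iff)
  also have "\<dots> \<longleftrightarrow> completely_decomposed Fp (u j) E"
  proof -
    have "\<one>\<^bsub>?G\<^esub> \<in> Z j"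
      using G.one_closed by (simp add: Z decomposition_group_def) (simp add: one_Gal)
    then have "f ` Z j = {c} \<longleftrightarrow> (\<forall>\<sigma>\<in>Z j. f \<sigma> = c)" for f :: "_ \<Rightarrow> 'a alg_closure \<Rightarrow> 'a alg_closure" and c
      by auto
    then show ?thesis
      by (simp only: completely_decomposed_def Z one_Gal)
  qed
  finally show ?thesis .
qed

end
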